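(* Let $k$ be a field and let $R=k\langle x,y\rangle$ be the free $k$-algebra on $x,y$. Then $\operatorname{diam}(R)$ is infinite.
   Context: All rings are unital. For elements $a,b$ of a ring $R$, write $a\sim_1 b$ if there exist $c,d\in R$ with $a=cd$ and $b=dc$; inductively, $a\sim_{n+1}b$ if there exists $c\in R$ with $a\sim_1 c$ and $c\sim_n b$; $a\sim_0 b$ means $a=b$. Write $a\sim b$ if $a\sim_n b$ for some $n$. The commutative closure of $a$ is $C(a)=\overline{\{a\}}=\{x\in R\mid x\sim a\}$. For $x,y\in C(a)$ put $d(x,y)=\min\{n\ge 0\mid y\sim_n x\}$, and $\operatorname{diam}(C(a))=\sup\{d(x,y)\mid x,y\in C(a)\}\in\mathbb{N}\cup\{\infty\}$. The diameter of the ring $R$ is $\operatorname{diam}(R)=\sup\{\operatorname{diam}(C(a))\mid a\in R\}$. *)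

theory Defs
  imports "HOL-Library.Poly_Mapping" "HOL-Library.Extended_Nat"
begin

text \<open>
  The free monoid on a type of letters: words under concatenation. It is written additively (with
  the empty word as zero) because the convolution product of \<^type>\<open>poly_mapping\<close> is
  indexed by a \<^class>\<open>monoid_add\<close>. Addition of words is not commutative.
\<close>

datatype 'a word = Word (letters: "'a list")

instantiation word :: (type) monoid_add
begin

definition zero_word :: "'a word" where
  "0 = Word []"

definition plus_word :: "'a word \<Rightarrow> 'a word \<Rightarrow> 'a word" where
  "u + v = Word (letters u @ letters v)"

instance
  by standard (simp_all add: zero_word_def plus_word_def)

end

text \<open>
  The free algebra is the monoid algebra of the free monoid: finitely supported functions from
  words to coefficients, with the convolution product of \<^theory>\<open>HOL-Library.Poly_Mapping\<close>.
\<close>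

type_synonym ('a, 'k) free_algebra = "'a word \<Rightarrow>\<^sub>0 'k"

datatype letter = X | Y

definition comm_step :: "'r::ring_1 \<Rightarrow> 'r \<Rightarrow> bool" where
  "comm_step a b \<longleftrightarrow> (\<exists>c d. a = c * d \<and> b = d * c)"

primrec comm_steps :: "nat \<Rightarrow> 'r::ring_1 \<Rightarrow> 'r \<Rightarrow> bool" where
  "comm_steps 0 a b \<longleftrightarrow> a = b"
| "comm_steps (Suc n) a b \<longleftrightarrow> (\<exists>c. comm_step a c \<and> comm_steps n c b)"

lemma comm_steps_1: "comm_steps 1 a b \<longleftrightarrow> comm_step a b"
  by simp

definition comm_rel :: "'r::ring_1 \<Rightarrow> 'r \<Rightarrow> bool" where
  "comm_rel a b \<longleftrightarrow> (\<exists>n. comm_steps n a b)"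

definition comm_closure :: "'r::ring_1 \<Rightarrow> 'r set" where
  "comm_closure a = {x. comm_rel x a}"

text \<open>Meaningful only if some \<open>n\<close> exists, as is the case for two elements of one commutative closure.\<close>

definition comm_dist :: "'r::ring_1 \<Rightarrow> 'r \<Rightarrow> nat" where
  "comm_dist x y = (LEAST n. comm_steps n y x)"

definition diam_closure :: "'r::ring_1 \<Rightarrow> enat" where
  "diam_closure a = (SUP (x, y) \<in> comm_closure a \<times> comm_closure a. enat (comm_dist x y))"

definition diam_ring :: "'r::ring_1 itself \<Rightarrow> enat" where
  "diam_ring _ = (SUP a :: 'r. diam_closure a)"

lemma comm_step_sym: "comm_step a b \<Longrightarrow> comm_step b a"
  unfolding comm_step_def by blast

lemma comm_steps_add: "comm_steps m a b \<Longrightarrow> comm_steps n b c \<Longrightarrow> comm_steps (m + n) a c"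
  by (induction m arbitrary: a) auto

lemma comm_steps_sym: "comm_steps n a b \<Longrightarrow> comm_steps n b a"
proof (induction n arbitrary: a)
  case (Suc n)
  then obtain c where "comm_step a c" "comm_steps n c b"
    by auto
  then have "comm_steps n b c" "comm_steps 1 c a"
    using Suc.IH comm_step_sym by (auto simp: comm_steps_1)
  then show ?case
    using comm_steps_add[of n b c 1 a] by simp
qed simp

lemma comm_steps_comm_dist:
  assumes "x \<in> comm_closure a" "y \<in> comm_closure a"
  shows "comm_steps (comm_dist x y) y x"
proof -
  obtain m n where "comm_steps m x a" "comm_steps n y a"
    using assms by (auto simp: comm_closure_def comm_rel_def)
  then have "comm_steps (n + m) y x"
    using comm_steps_sym comm_steps_add by blast
  then show ?thesis
    unfolding comm_dist_def by (rule LeastI)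
qed

end

theory Submission
  imports Defs
begin

text \<open>
  In the class of \<open>b\<^sub>i = x\<^sup>i y x\<^sup>m\<^sup>-\<^sup>i + x\<close> (\<open>0 \<le> i \<le> m\<close>) the relation \<open>\<sim>\<^sub>1\<close> is the path
  \<open>b\<^sub>0, b\<^sub>1, \<dots>, b\<^sub>m\<close>: with \<open>f\<^sub>i = x\<^sup>i y x\<^sup>m\<^sup>-\<^sup>i\<^sup>-\<^sup>1 + 1\<close> one has \<open>b\<^sub>i = f\<^sub>i x = x f\<^sub>i\<^sub>-\<^sub>1\<close>, and up to scalars
  these are the only proper factorizations of \<open>b\<^sub>i\<close>. Hence \<open>b\<^sub>0\<close> and \<open>b\<^sub>m\<close> have distance at least \<open>m\<close>.
  The factorizations are determined by comparing the extremal words of both sides for two monomial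
  orders, which rank words first by their number of occurrences of \<open>y\<close>, increasingly or decreasingly.
  Below, \<open>b\<^sub>i\<close> is \<open>path_elem i (m - i)\<close> and \<open>a f\<^sub>i\<close> is \<open>path_factor i (m - i - 1) a\<close> for a scalar \<open>a\<close>.
\<close>

abbreviation "keys \<equiv> Poly_Mapping.keys"
abbreviation "lookup \<equiv> Poly_Mapping.lookup"

section \<open>Leading words\<close>

text \<open>These axioms are preserved when \<open>r\<close> is reversed, so each order comes with
  its converse. Maxima are only ever taken over finite supports.\<close>

locale bi_order =
  fixes r :: "'a::monoid_add \<Rightarrow> 'a \<Rightarrow> bool"
  assumes irrefl: "\<not> r u u"
    and trans: "r u v \<Longrightarrow> r v w \<Longrightarrow> r u w"
    and total: "u \<noteq> v \<Longrightarrow> r u v \<or> r v u"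
    and add_left: "r u v \<Longrightarrow> r (w + u) (w + v)"
    and add_right: "r u v \<Longrightarrow> r (u + w) (v + w)"

lemma bi_order_conversep: "bi_order r \<Longrightarrow> bi_order r\<inverse>\<inverse>"
  unfolding bi_order_def conversep_iff by metis

definition leading :: "('a \<Rightarrow> 'a \<Rightarrow> bool) \<Rightarrow> ('a \<Rightarrow>\<^sub>0 'k::zero) \<Rightarrow> 'a \<Rightarrow> bool" where
  "leading r p w \<longleftrightarrow> w \<in> keys p \<and> (\<forall>v\<in>keys p. v \<noteq> w \<longrightarrow> r v w)"

lemma leading_in_keys: "leading r p w \<Longrightarrow> w \<in> keys p"
  by (simp add: leading_def)

lemma leadingD: "leading r p w \<Longrightarrow> v \<in> keys p \<Longrightarrow> v = w \<or> r v w"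
  by (auto simp: leading_def)

context bi_order
begin

lemma leading_unique: "leading r p u \<Longrightarrow> leading r p v \<Longrightarrow> u = v"
  unfolding leading_def using irrefl trans by metis

lemma leading_exists:
  assumes "p \<noteq> 0"
  obtains w where "leading r p w"
proof -
  have "\<exists>w\<in>A. \<forall>v\<in>A. v \<noteq> w \<longrightarrow> r v w" if "finite A" "A \<noteq> {}" for A :: "'a set"
    using that
  proof (induction rule: finite_ne_induct)
    case (insert x F)
    then obtain w where "w \<in> F" "\<forall>v\<in>F. v \<noteq> w \<longrightarrow> r v w"
      by blast
    then show ?case
      using total[of x w] trans by (metis insert_iff)
  qed simp
  from this[of "keys p"] assms that show thesis
    by (auto simp: leading_def)
qed

text \<open>Split off the leading terms of both factors. The product is then a single term at
  \<open>u + v\<close> with nonzero coefficient, plus a rest \<open>s\<close> whose words lie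
  strictly below \<open>u + v\<close> by monotonicity on both sides.\<close>

lemma leading_mult:
  fixes p q :: "'a \<Rightarrow>\<^sub>0 'k::ring_1_no_zero_divisors"
  assumes p: "leading r p u" and q: "leading r q v"
  shows "leading r (p * q) (u + v)"
proof -
  define p' where "p' = p - Poly_Mapping.single u (lookup p u)"
  define q' where "q' = q - Poly_Mapping.single v (lookup q v)"
  have p': "r w u" if "w \<in> keys p'" for w
  proof -
    have "w \<noteq> u" "w \<in> keys p"
      using that by (auto simp: p'_def in_keys_iff lookup_minus lookup_single when_def split: if_splits)
    then show ?thesis
      using leadingD[OF p] by blast
  qed
  have q': "r w v" if "w \<in> keys q'" for w
  proof -
    have "w \<noteq> v" "w \<in> keys q"
      using that by (auto simp: q'_def in_keys_iff lookup_minus lookup_single when_def split: if_splits)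
    then show ?thesis
      using leadingD[OF q] by blast
  qed
  define t where "t = Poly_Mapping.single (u + v) (lookup p u * lookup q v)"
  define s where "s = Poly_Mapping.single u (lookup p u) * q' + p' * q"
  have "p * q = t + s"
    by (simp add: t_def s_def p'_def q'_def algebra_simps mult_single)
  have s: "r w (u + v)" if "w \<in> keys s" for w
  proof -
    have "w \<in> keys (Poly_Mapping.single u (lookup p u) * q') \<or> w \<in> keys (p' * q)"
      using that keys_add[of "Poly_Mapping.single u (lookup p u) * q'" "p' * q"] by (auto simp: s_def)
    then show ?thesis
    proof
      assume "w \<in> keys (Poly_Mapping.single u (lookup p u) * q')"
      then obtain a b where "w = a + b" "a \<in> keys (Poly_Mapping.single u (lookup p u))" "b \<in> keys q'"
        using keys_mult[of "Poly_Mapping.single u (lookup p u)" q'] by blast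
      then show ?thesis
        using q' add_left by (auto split: if_splits)
    next
      assume "w \<in> keys (p' * q)"
      then obtain a b where "w = a + b" "a \<in> keys p'" "b \<in> keys q"
        using keys_mult[of p' q] by blast
      \<comment> \<open>Here \<open>b\<close> may equal \<open>v\<close>, but \<open>a\<close> lies
        strictly below \<open>u\<close>: \<open>a + b\<close> is at most \<open>a + v\<close>, which
        is below \<open>u + v\<close>.\<close>
      then show ?thesis
        using p'[of a] leadingD[OF q, of b] add_left[of b v a] add_right[of a u v] trans by metis
    qed
  qed
  then have "u + v \<notin> keys s"
    using irrefl by blast
  moreover have nz: "lookup p u * lookup q v \<noteq> 0"
    using p q by (simp add: leading_def in_keys_iff)
  ultimately have "u + v \<in> keys (t + s)"
    by (simp add: in_keys_iff lookup_add t_def)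
  moreover have "w = u + v \<or> r w (u + v)" if "w \<in> keys (t + s)" for w
    using that keys_add[of t s] s nz by (auto simp: t_def)
  ultimately show ?thesis
    unfolding \<open>p * q = t + s\<close> leading_def by blast
qed

text \<open>A product of nonzero elements has a leading word. This permits the cancellation of
  factors in \<open>comm_step_path_elem\<close>.\<close>

lemma mult_eq_0_iff_leading:
  fixes p q :: "'a \<Rightarrow>\<^sub>0 'k::ring_1_no_zero_divisors"
  shows "p * q = 0 \<longleftrightarrow> p = 0 \<or> q = 0"
  by (metis leading_exists leading_mult leading_in_keys keys_zero empty_iff mult_zero_left mult_zero_right)

end

section \<open>Orders on words\<close>

text \<open>Ties are broken by length before letters: a purely lexicographic comparison would not be
  compatible with appending on the right. Integer values admit the negated count of \<open>Y\<close>
  as a weight.\<close>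

definition weight_less :: "(letter word \<Rightarrow> int) \<Rightarrow> letter word \<Rightarrow> letter word \<Rightarrow> bool" where
  "weight_less f u v \<longleftrightarrow> f u < f v \<or> f u = f v \<and> (letters u, letters v) \<in> lenlex {(X, Y)}"

lemma letters_plus [simp]: "letters (u + v) = letters u @ letters v"
  by (simp add: plus_word_def)

lemma letters_zero [simp]: "letters 0 = []"
  by (simp add: zero_word_def)

lemma bi_order_weight_less:
  assumes f: "\<And>u v. f (u + v) = f u + f v"
  shows "bi_order (weight_less f)"
proof
  have irr: "irrefl {(X, Y)}"
    by (auto simp: irrefl_def)
  have tot: "total (lenlex {(X, Y)})"
    by (rule total_lenlex) (metis (mono_tags) letter.exhaust insertI1 total_onI)
  have trn: "trans (lenlex {(X, Y)})"
    by (rule lenlex_transI) (auto simp: trans_def)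
  fix u v w
  show "\<not> weight_less f u u"
    using lenlex_irreflexive[of "{(X, Y)}"] by (auto simp: weight_less_def)
  show "weight_less f u w" if "weight_less f u v" "weight_less f v w"
    using that transD[OF trn] unfolding weight_less_def by fastforce
  show "weight_less f u v \<or> weight_less f v u" if "u \<noteq> v"
  proof -
    have "letters u \<noteq> letters v"
      using that word.expand by blast
    then show ?thesis
      using tot unfolding weight_less_def total_on_def by fastforce
  qed
  show "weight_less f (w + u) (w + v)" if "weight_less f u v"
    using that by (auto simp: weight_less_def f lenlex_append2[OF irr])
  show "weight_less f (u + w) (v + w)" if "weight_less f u v"
    using that by (auto simp: weight_less_def f intro: lenlex_append1)
qed

definition ycount :: "letter word \<Rightarrow> int" where
  "ycount w = int (count_list (letters w) Y)"

lemma ycount_add: "ycount (u + v) = ycount u + ycount v"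
  by (simp add: ycount_def)

lemma ycount_nonneg: "ycount w \<ge> 0"
  by (simp add: ycount_def)

text \<open>Both \<open>ymin\<close> and the converse of \<open>ymax\<close> favour words with few
  \<open>Y\<close>, but among these \<open>ymin\<close> prefers long words and the converse of
  \<open>ymax\<close> short ones. Together they bound the lengths of the \<open>Y\<close>-free words
  of a factor from both sides.\<close>

abbreviation "ymax \<equiv> weight_less ycount"
abbreviation "ymin \<equiv> weight_less (\<lambda>w. - ycount w)"

interpretation ymax: bi_order ymax
  by (rule bi_order_weight_less) (simp add: ycount_add)

interpretation ymax_conv: bi_order "ymax\<inverse>\<inverse>"
  by (rule bi_order_conversep) (rule ymax.bi_order_axioms)

interpretation ymin: bi_order ymin
  by (rule bi_order_weight_less) (simp add: ycount_add)

abbreviation wlen :: "letter word \<Rightarrow> nat" where "wlen w \<equiv> length (letters w)"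

lemma leading_ymax:
  "leading ymax p w \<Longrightarrow> v \<in> keys p \<Longrightarrow> ycount v \<le> ycount w"
  by (auto simp: weight_less_def dest!: leadingD)

lemma leading_ymax_conv:
  "leading ymax\<inverse>\<inverse> p w \<Longrightarrow> v \<in> keys p \<Longrightarrow> ycount w \<le> ycount v \<and> (ycount v = ycount w \<longrightarrow> wlen w \<le> wlen v)"
  by (auto simp: weight_less_def dest!: leadingD lenlex_length)

lemma leading_ymin:
  "leading ymin p w \<Longrightarrow> v \<in> keys p \<Longrightarrow> ycount w \<le> ycount v \<and> (ycount v = ycount w \<longrightarrow> wlen v \<le> wlen w)"
  by (auto simp: weight_less_def dest!: leadingD lenlex_length)

section \<open>The path\<close>

abbreviation wx :: "letter word" where "wx \<equiv> Word [X]"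

definition xyx :: "nat \<Rightarrow> nat \<Rightarrow> letter word" where
  "xyx i j = Word (replicate i X @ Y # replicate j X)"

definition path_elem :: "nat \<Rightarrow> nat \<Rightarrow> (letter, 'k::field) free_algebra" where
  "path_elem i j = Poly_Mapping.single (xyx i j) 1 + Poly_Mapping.single wx 1"

lemma ycount_xyx [simp]: "ycount (xyx i j) = 1"
  by (simp add: ycount_def xyx_def)

lemma ycount_wx [simp]: "ycount wx = 0"
  by (simp add: ycount_def)

lemma ycount_zero [simp]: "ycount 0 = 0"
  by (simp add: ycount_def)

lemma xyx_neq_wx [simp]: "xyx i j \<noteq> wx" "wx \<noteq> xyx i j"
  by (metis ycount_xyx ycount_wx zero_neq_one)+

lemma xyx_plus_wx: "xyx i j + wx = xyx i (Suc j)"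
  by (simp add: xyx_def plus_word_def replicate_append_same)

lemma wx_plus_xyx: "wx + xyx i j = xyx (Suc i) j"
  by (simp add: xyx_def plus_word_def)

lemma keys_path_elem: "keys (path_elem i j :: (letter, 'k::field) free_algebra) = {xyx i j, wx}"
  by (auto simp: path_elem_def in_keys_iff lookup_add lookup_single when_def split: if_splits)

lemma path_elem_nonzero: "path_elem i j \<noteq> 0"
  using keys_path_elem[of i j] by (metis keys_zero insert_not_empty)

lemma leading_path_elem:
  "leading ymax (path_elem i j) (xyx i j)" "leading ymax\<inverse>\<inverse> (path_elem i j) wx" "leading ymin (path_elem i j) wx"
  by (auto simp: leading_def keys_path_elem weight_less_def)

section \<open>Factorizations of a path element\<close>

lemma plus_eq_wx: "u + v = wx \<longleftrightarrow> u = 0 \<and> v = wx \<or> u = wx \<and> v = 0"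
  by (cases u; cases v) (auto simp: plus_word_def zero_word_def append_eq_Cons_conv)

lemma eq_single_if_keys:
  assumes "p \<noteq> 0" "\<And>v. v \<in> keys p \<Longrightarrow> v = w"
  obtains a where "a \<noteq> 0" "p = Poly_Mapping.single w a"
proof
  show "p = Poly_Mapping.single w (lookup p w)"
    using assms(2) by (intro poly_mapping_eqI) (auto simp: lookup_single when_def in_keys_iff)
  then show "lookup p w \<noteq> 0"
    using assms(1) by (metis single_zero)
qed

lemma letters_eq_Nil: "letters w = [] \<longleftrightarrow> w = 0"
  by (cases w) (simp add: zero_word_def)

lemma wx_if_ycount_wlen: "ycount w = 0 \<Longrightarrow> wlen w = 1 \<Longrightarrow> w = wx"
  by (cases w) (auto simp: ycount_def length_Suc_conv split: if_splits, metis letter.exhaust)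

text \<open>All words of \<open>d\<close> are \<open>Y\<close>-free, hence powers of
  \<open>X\<close>, and their lengths lie between those of \<open>v0\<close> and \<open>v2\<close>.
  No product \<open>c * d\<close> is mentioned, so that the lemma serves for a right and for a left
  factor \<open>d\<close>.\<close>

lemma factor_cases:
  fixes c d :: "(letter, 'k::field) free_algebra"
  assumes "leading ymax\<inverse>\<inverse> c u0" "leading ymax\<inverse>\<inverse> d v0" "u0 = 0 \<and> v0 = wx \<or> u0 = wx \<and> v0 = 0"
    and "leading ymin c u2" "leading ymin d v2" "u2 = 0 \<and> v2 = wx \<or> u2 = wx \<and> v2 = 0"
    and "leading ymax d v1" "ycount v1 = 0"
  obtains a where "a \<noteq> 0" "d = Poly_Mapping.single 0 a"
  | a where "a \<noteq> 0" "d = Poly_Mapping.single wx a" "leading ymax d wx"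
proof -
  have d: "d \<noteq> 0"
    using assms(5) by (auto simp: leading_def)
  have y: "ycount v = 0" if "v \<in> keys d" for v
    using leading_ymax[OF assms(7) that] assms(8) ycount_nonneg[of v] by simp
  consider "v2 = 0" | "u2 = 0" "v2 = wx"
    using assms(6) by blast
  then show thesis
  proof cases
    case 1
    have "v = 0" if "v \<in> keys d" for v
      using leading_ymin[OF assms(5) that] y[OF that] 1 by (simp add: letters_eq_Nil)
    then show thesis
      using eq_single_if_keys[OF d] that(1) by blast
  next
    case 2
    \<comment> \<open>The word \<open>u0\<close> would be a \<open>Y\<close>-free word of
      \<open>c\<close> longer than \<open>u2\<close>, the longest one.\<close>
    have "u0 \<noteq> wx"
      using leading_ymin[OF assms(4) leading_in_keys[OF assms(1)]] 2 by auto
    then have "v0 = wx"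
      using assms(3) by blast
    have w: "v = wx" if "v \<in> keys d" for v
      using leading_ymin[OF assms(5) that] leading_ymax_conv[OF assms(2) that] y[OF that] 2 \<open>v0 = wx\<close>
      by (intro wx_if_ycount_wlen) auto
    then have "leading ymax d wx"
      using assms(7) w[OF leading_in_keys[OF assms(7)]] by simp
    then show thesis
      using eq_single_if_keys[OF d w] that(2) by blast
  qed
qed

lemma xyx_eq_plus_wx: "u + wx = xyx i j \<Longrightarrow> \<exists>j'. j = Suc j'"
  by (cases j) (auto simp: plus_word_def xyx_def)

lemma xyx_eq_wx_plus: "wx + u = xyx i j \<Longrightarrow> \<exists>i'. i = Suc i'"
  by (cases i) (auto simp: plus_word_def xyx_def)

definition path_factor :: "nat \<Rightarrow> nat \<Rightarrow> 'k \<Rightarrow> (letter, 'k::field) free_algebra" where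
  "path_factor i j a = Poly_Mapping.single (xyx i j) a + Poly_Mapping.single 0 a"

text \<open>Together with \<open>x_mult_path_factor\<close> this gives the edges of the path:
  swapping the two factors moves one \<open>X\<close> across the \<open>Y\<close>.\<close>

lemma path_factor_mult_x: "a * a' = 1 \<Longrightarrow> path_factor i j a * Poly_Mapping.single wx a' = path_elem i (Suc j)"
  by (simp add: path_factor_def path_elem_def distrib_right mult_single xyx_plus_wx)

lemma x_mult_path_factor: "a * a' = 1 \<Longrightarrow> Poly_Mapping.single wx a' * path_factor i j a = path_elem (Suc i) j"
  by (simp add: path_factor_def path_elem_def distrib_left mult_single wx_plus_xyx mult.commute)

lemma single_0_mult_commute:
  "Poly_Mapping.single 0 a * (p :: (letter, 'k::field) free_algebra) = p * Poly_Mapping.single 0 a"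
proof -
  have "p = (\<Sum>w\<in>keys p. Poly_Mapping.single w (lookup p w))"
    by (rule poly_mapping_eqI) (simp add: lookup_sum lookup_single when_def in_keys_iff)
  \<comment> \<open>Abstracting the index set and the coefficients keeps \<open>p\<close> out of the
    right-hand side, so that rewriting with the equation terminates.\<close>
  then obtain A g where "p = (\<Sum>w\<in>A. Poly_Mapping.single w (g w))"
    by blast
  then show ?thesis
    by (simp add: sum_distrib_left sum_distrib_right mult_single mult.commute)
qed

text \<open>Leading words add up, so the word with one \<open>Y\<close> leaves one factor
  \<open>Y\<close>-free; by \<open>factor_cases\<close> that factor is a scalar or a scalar multiple
  of \<open>X\<close>. A scalar is central and gives \<open>e = path_elem i j\<close>; otherwise
  cancellation determines the other factor, and \<open>e\<close> is a neighbour on the path. The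
  bound on \<open>i'\<close> limits how fast a walk can climb.\<close>

lemma comm_step_path_elem:
  fixes e :: "(letter, 'k::field) free_algebra"
  assumes "comm_step (path_elem i j) e"
  obtains i' j' where "e = path_elem i' j'" "i' + j' = i + j" "i' \<le> Suc i"
proof -
  obtain c d where cd: "path_elem i j = c * d" "e = d * c"
    using assms by (auto simp: comm_step_def)
  have c: "c \<noteq> 0" and d: "d \<noteq> 0"
    using cd(1) path_elem_nonzero[of i j] by auto
  obtain u0 v0 where l0: "leading ymax\<inverse>\<inverse> c u0" "leading ymax\<inverse>\<inverse> d v0"
    using ymax_conv.leading_exists[OF c] ymax_conv.leading_exists[OF d] by metis
  obtain u1 v1 where l1: "leading ymax c u1" "leading ymax d v1"
    using ymax.leading_exists[OF c] ymax.leading_exists[OF d] by metis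
  obtain u2 v2 where l2: "leading ymin c u2" "leading ymin d v2"
    using ymin.leading_exists[OF c] ymin.leading_exists[OF d] by metis
  have s0: "u0 + v0 = wx"
    using ymax_conv.leading_unique[OF ymax_conv.leading_mult[OF l0]] leading_path_elem(2) cd(1) by metis
  have s1: "u1 + v1 = xyx i j"
    using ymax.leading_unique[OF ymax.leading_mult[OF l1]] leading_path_elem(1) cd(1) by metis
  have s2: "u2 + v2 = wx"
    using ymin.leading_unique[OF ymin.leading_mult[OF l2]] leading_path_elem(3) cd(1) by metis
  note e0 = s0[unfolded plus_eq_wx] and e2 = s2[unfolded plus_eq_wx]
  have "ycount u1 + ycount v1 = 1"
    using s1 by (metis ycount_add ycount_xyx)
  then consider "ycount v1 = 0" | "ycount u1 = 0"
    using ycount_nonneg[of u1] ycount_nonneg[of v1] by linarith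
  then show thesis
  proof cases
    case 1
    show thesis
    proof (rule factor_cases[OF l0 e0 l2 e2 l1(2) 1])
      fix a :: 'k assume "d = Poly_Mapping.single 0 a"
      then have "e = path_elem i j"
        using cd by (simp add: single_0_mult_commute)
      then show thesis
        using that by simp
    next
      fix a :: 'k assume a: "a \<noteq> 0" and d: "d = Poly_Mapping.single wx a" and "leading ymax d wx"
      then have "v1 = wx"
        using l1(2) ymax.leading_unique by blast
      then obtain k where j: "j = Suc k"
        using s1 xyx_eq_plus_wx by blast
      \<comment> \<open>Both \<open>c\<close> and the expected cofactor give
        \<open>path_elem i j\<close> when multiplied by \<open>d\<close>, so they agree by
        cancellation.\<close>
      have "(c - path_factor i k (inverse a)) * d = 0"
        using cd(1) path_factor_mult_x[of "inverse a" a i k] a by (simp add: left_diff_distrib d j)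
      then have "c = path_factor i k (inverse a)"
        using \<open>d \<noteq> 0\<close> by (simp add: ymax.mult_eq_0_iff_leading)
      then have "e = path_elem (Suc i) k"
        using cd(2) d x_mult_path_factor[of "inverse a" a i k] a by simp
      then show thesis
        using that j by simp
    qed
  next
    case 2
    \<comment> \<open>The mirror image: \<open>c\<close> now takes the role of \<open>d\<close> in
      \<open>factor_cases\<close>, which requires the alternatives with the factors
      exchanged.\<close>
    have e0': "v0 = 0 \<and> u0 = wx \<or> v0 = wx \<and> u0 = 0" and e2': "v2 = 0 \<and> u2 = wx \<or> v2 = wx \<and> u2 = 0"
      using e0 e2 by blast+
    show thesis
    proof (rule factor_cases[OF l0(2) l0(1) e0' l2(2) l2(1) e2' l1(1) 2])
      fix a :: 'k assume "c = Poly_Mapping.single 0 a"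
      then have "e = path_elem i j"
        using cd by (simp add: single_0_mult_commute)
      then show thesis
        using that by simp
    next
      fix a :: 'k assume a: "a \<noteq> 0" and c: "c = Poly_Mapping.single wx a" and "leading ymax c wx"
      then have "u1 = wx"
        using l1(1) ymax.leading_unique by blast
      then obtain k where i: "i = Suc k"
        using s1 xyx_eq_wx_plus by blast
      have "c * (d - path_factor k j (inverse a)) = 0"
        using cd(1) x_mult_path_factor[of "inverse a" a k j] a by (simp add: right_diff_distrib c i)
      then have "d = path_factor k j (inverse a)"
        using \<open>c \<noteq> 0\<close> by (simp add: ymax.mult_eq_0_iff_leading)
      then have "e = path_elem k (Suc j)"
        using cd(2) c path_factor_mult_x[of "inverse a" a k j] a by simp
      then show thesis
        using that i by simp
    qed
  qed
qed

section \<open>Walks along the path and the diameter\<close>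

lemma comm_steps_path_elem:
  "comm_steps n (path_elem i j) (e :: (letter, 'k::field) free_algebra) \<Longrightarrow>
    \<exists>i' j'. e = path_elem i' j' \<and> i' + j' = i + j \<and> i' \<le> n + i"
proof (induction n arbitrary: i j)
  case 0
  then show ?case by auto
next
  case (Suc n)
  then obtain c where c: "comm_step (path_elem i j) c" "comm_steps n c e"
    by auto
  from c(1) obtain i1 j1 where "c = path_elem i1 j1" "i1 + j1 = i + j" "i1 \<le> Suc i"
    by (rule comm_step_path_elem)
  then show ?case
    using Suc.IH[of i1 j1] c(2) by fastforce
qed

lemma path_elem_inject:
  assumes "path_elem i j = (path_elem i' j' :: (letter, 'k::field) free_algebra)"
  shows "i = i'"
proof -
  have "xyx i j = xyx i' j'"
    using assms ymax.leading_unique leading_path_elem(1) by metis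
  \<comment> \<open>The initial run of \<open>X\<close> in \<open>xyx i j\<close> has length
    \<open>i\<close>.\<close>
  then have "takeWhile ((=) X) (letters (xyx i j)) = takeWhile ((=) X) (letters (xyx i' j'))"
    by simp
  then show ?thesis
    by (simp add: xyx_def takeWhile_append)
qed

text \<open>This places both ends of the path in one commutative closure, so that their distance is
  attained by an actual walk.\<close>

lemma comm_steps_path: "comm_steps n (path_elem i (n + j)) (path_elem (n + i) j :: (letter, 'k::field) free_algebra)"
proof (induction n arbitrary: i)
  case (Suc n)
  have "comm_step (path_elem i (Suc (n + j))) (path_elem (Suc i) (n + j) :: (letter, 'k) free_algebra)"
    unfolding comm_step_def
    using path_factor_mult_x[of 1 1 i "n + j"] x_mult_path_factor[of 1 1 i "n + j"] by (metis mult_1)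
  then show ?case
    using Suc[of "Suc i"] by auto
qed simp

theorem theorem2p4:
  shows "diam_ring TYPE((letter, 'k::field) free_algebra) = \<infinity>"
proof -
  have "enat m \<le> diam_ring TYPE((letter, 'k) free_algebra)" for m
  proof -
    define s t where "s = (path_elem 0 m :: (letter, 'k) free_algebra)" and "t = (path_elem m 0 :: (letter, 'k) free_algebra)"
    have "comm_steps m s t"
      using comm_steps_path[of m 0 0] by (simp add: s_def t_def)
    then have t: "t \<in> comm_closure s" and s: "s \<in> comm_closure s"
      using comm_steps_sym comm_steps.simps(1) unfolding comm_closure_def comm_rel_def by blast+
    have "comm_steps (comm_dist t s) s t"
      using comm_steps_comm_dist[OF t s] .
    \<comment> \<open>A walk starting at index 0 reaches an index no larger than its number of
      steps, while \<open>t\<close> has index \<open>m\<close>.\<close>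
    then obtain i j where "t = path_elem i j" "i \<le> comm_dist t s"
      using comm_steps_path_elem[of "comm_dist t s" 0 m t] by (auto simp: s_def)
    moreover from this have "i = m"
      using path_elem_inject t_def by metis
    ultimately have "enat m \<le> enat (comm_dist t s)"
      by simp
    also have "\<dots> \<le> diam_closure s"
      unfolding diam_closure_def using s t by (intro SUP_upper2[of "(t, s)"]) auto
    also have "\<dots> \<le> diam_ring TYPE((letter, 'k) free_algebra)"
      unfolding diam_ring_def by (rule SUP_upper) simp
    finally show ?thesis .
  qed
  then show ?thesis
    \<comment> \<open>A finite diameter \<open>n\<close> would contradict the bound for
      \<open>Suc n\<close>.\<close>
    by (metis Suc_n_not_le_n enat_ord_simps(1) not_infinity_eq)
qed

end
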